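(* Let $n$ be a positive integer. Then $\psi(n)=1+\sum_{d\mid n,\,d\neq n}\psi(d)$, with the initial value $\psi(1)=1$. Furthermore, $\psi(p^\alpha)=2^\alpha$ for any prime $p$ and any positive integer $\alpha$.
   Context: A chain $\{a_1\prec\cdots\prec a_k\}$ ($k\ge1$) in a finite poset is a conquester chain if its largest element $a_k$ is a maximal element of the poset. For a positive integer $n$, $\psi(n)$ denotes the number of conquester chains (including the singleton one) in the poset $\Delta_n=\{d: d\mid n\}$ of positive divisors of $n$ ordered by divisibility. *)

theory Defs
  imports "HOL-Computational_Algebra.Primes"
begin

definition maximal_element :: "('a \<Rightarrow> 'a \<Rightarrow> bool) \<Rightarrow> 'a set \<Rightarrow> 'a \<Rightarrow> bool" where
  "maximal_element le P m \<longleftrightarrow> m \<in> P \<and> (\<forall>x\<in>P. le m x \<longrightarrow> x = m)"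

(* P is the carrier of the poset and le its non-strict order; a chain is represented by
   its underlying set, so {a_1 < ... < a_k} is a finite nonempty totally ordered subset. *)
definition conquester_chain :: "('a \<Rightarrow> 'a \<Rightarrow> bool) \<Rightarrow> 'a set \<Rightarrow> 'a set \<Rightarrow> bool" where
  "conquester_chain le P C \<longleftrightarrow>
     C \<subseteq> P \<and> finite C \<and> C \<noteq> {} \<and> Complete_Partial_Order.chain le C \<and>
     (\<exists>m\<in>C. (\<forall>c\<in>C. le c m) \<and> maximal_element le P m)"

(* Only meaningful for n > 0: every natural number divides 0. *)
definition \<psi> :: "nat \<Rightarrow> nat" where
  "\<psi> n = card {C. conquester_chain (dvd) {d. d dvd n} C}"

end

theory Submission
  imports Defs
begin

text \<open>The divisor poset of \<open>n > 0\<close> has the single maximal element \<open>n\<close>, so a conquester chain is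
  just a chain of divisors that contains \<open>n\<close> (lemma \<open>conquester_chain_divisors_iff\<close>). Deleting
  \<open>n\<close> from such a chain leaves either nothing or a chain with a greatest element \<open>d\<close>, a proper
  divisor of \<open>n\<close>; the remainder is then a conquester chain of the divisor poset of \<open>d\<close>. Conversely,
  \<open>n\<close> can be put on top of any of those. As the greatest element \<open>d\<close> is determined by
  the chain, this gives a disjoint decomposition (lemmas \<open>conquester_chains_decomposition\<close> and
  \<open>conquester_chains_disjoint\<close>), and counting it yields the recurrence. The proper divisors of
  \<open>p ^ \<alpha>\<close> are the \<open>p ^ i\<close> with \<open>i < \<alpha>\<close>, so there the recurrence becomes
  \<open>1 + (1 + 2 + \<dots> + 2 ^ (\<alpha> - 1)) = 2 ^ \<alpha>\<close>.\<close>

definition conquester_chains :: "nat \<Rightarrow> nat set set" where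
  "conquester_chains n = {C. conquester_chain (dvd) {d. d dvd n} C}"

lemma psi_eq_card_conquester_chains: "\<psi> n = card (conquester_chains n)"
  by (simp add: \<psi>_def conquester_chains_def)

text \<open>The maximal element required by the definition can only be \<open>n\<close>, and \<open>n\<close> lies above every
  divisor, so all conditions on the top of the chain reduce to membership of \<open>n\<close>.\<close>
lemma conquester_chain_divisors_iff:
  assumes "n > 0"
  shows "C \<in> conquester_chains n \<longleftrightarrow>
    C \<subseteq> {d. d dvd n} \<and> n \<in> C \<and> Complete_Partial_Order.chain (dvd) C"
proof -
  have maximal: "maximal_element (dvd) {d. d dvd n} m \<longleftrightarrow> m = n" for m
    by (auto simp: maximal_element_def intro: dvd_antisym)
  have "finite C" if "C \<subseteq> {d. d dvd n}"
    using that finite_divisors_nat[OF assms] by (rule finite_subset)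
  then show ?thesis
    by (auto simp: conquester_chains_def conquester_chain_def maximal)
qed

lemma finite_conquester_chains:
  assumes "n > 0"
  shows "finite (conquester_chains n)"
proof (rule finite_subset)
  show "conquester_chains n \<subseteq> Pow {d. d dvd n}"
    by (auto simp: conquester_chains_def conquester_chain_def)
  show "finite (Pow {d. d dvd n})"
    using finite_divisors_nat[OF assms] by simp
qed

text \<open>For positive numbers divisibility refines the usual order, so the numerically largest member
  of a chain is a multiple of all the others.\<close>
lemma dvd_chain_Max:
  fixes C :: "nat set"
  assumes "finite C" "Complete_Partial_Order.chain (dvd) C" "0 \<notin> C" "c \<in> C"
  shows "c dvd Max C"
proof -
  have "Max C \<in> C" "c \<le> Max C"
    using assms by (auto intro: Max_in)
  moreover have "c dvd Max C \<or> Max C dvd c"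
    using assms \<open>Max C \<in> C\<close> by (auto dest: chainD)
  ultimately show ?thesis
    using assms(3,4) by (metis dvd_imp_le dvd_refl gr0I le_antisym)
qed

lemma proper_divisor_chain_notin:
  fixes n :: nat
  assumes "d dvd n" "d \<noteq> n" "C \<in> conquester_chains d"
  shows "n \<notin> C"
  using assms
  by (auto simp: conquester_chains_def conquester_chain_def dest: dvd_antisym)

lemma conquester_chains_decomposition:
  assumes "n > 0"
  shows "conquester_chains n =
    insert {n} (\<Union>d\<in>{d. d dvd n \<and> d \<noteq> n}. insert n ` conquester_chains d)"
    (is "_ = ?R")
proof (intro set_eqI iffI)
  fix C assume "C \<in> conquester_chains n"
  then have C: "C \<subseteq> {d. d dvd n}" "n \<in> C" "Complete_Partial_Order.chain (dvd) C"
    using assms by (auto simp: conquester_chain_divisors_iff)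
  show "C \<in> ?R"
  proof (cases "C = {n}")
    case False
    define D where "D = C - {n}"
    have D: "D \<noteq> {}" "finite D" "0 \<notin> D" "C = insert n D" "D \<subseteq> C" "n \<notin> D"
      using C False assms finite_subset[OF C(1)] by (auto simp: D_def)
    have chain: "Complete_Partial_Order.chain (dvd) D"
      using C(3) D(5) by (rule chain_subset)
    have Max: "Max D \<in> D"
      using D by simp
    have "Max D dvd n"
      using Max C(1) D(5) by blast
    moreover have "Max D \<noteq> n"
      using Max D(6) by metis
    moreover have "Max D > 0"
      using Max D(3) by (metis gr0I)
    moreover have "D \<in> conquester_chains (Max D)"
      using dvd_chain_Max[OF D(2) chain D(3)] chain Max \<open>Max D > 0\<close>
      by (auto simp: conquester_chain_divisors_iff)
    ultimately show ?thesis
      using D(4) by blast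
  qed simp
next
  fix C assume "C \<in> ?R"
  then consider "C = {n}"
    | d D where "d dvd n" "d \<noteq> n" "D \<in> conquester_chains d" "C = insert n D"
    by blast
  then show "C \<in> conquester_chains n"
  proof cases
    case 1
    then show ?thesis
      using assms by (simp add: conquester_chain_divisors_iff chain_def)
  next
    case 2
    have "d > 0"
      using 2(1) assms by (auto intro: gr0I)
    then have D: "D \<subseteq> {e. e dvd d}" "Complete_Partial_Order.chain (dvd) D"
      using 2(3) by (auto simp: conquester_chain_divisors_iff)
    have "e dvd n" if "e \<in> D" for e
      using that D(1) 2(1) by (auto intro: dvd_trans)
    with D(2) 2(4) assms show ?thesis
      by (auto simp: conquester_chain_divisors_iff chain_def)
  qed
qed

text \<open>A chain is conquester in only one divisor poset, since its greatest element is
  determined by the chain.\<close>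
lemma conquester_chains_disjoint:
  assumes "C \<in> conquester_chains d" "C \<in> conquester_chains e" "d > 0" "e > 0"
  shows "d = e"
  using assms by (auto simp: conquester_chain_divisors_iff intro: dvd_antisym)

lemma psi_recurrence:
  assumes "n > 0"
  shows "\<psi> n = 1 + (\<Sum>d | d dvd n \<and> d \<noteq> n. \<psi> d)"
proof -
  let ?D = "{d. d dvd n \<and> d \<noteq> n}"
  let ?K = "\<lambda>d. insert n ` conquester_chains d"
  have fin: "finite ?D"
    using finite_divisors_nat[OF assms] by (rule rev_finite_subset) auto
  have pos: "d > 0" if "d \<in> ?D" for d
    using that assms by (auto intro: gr0I)
  have finK: "finite (?K d)" if "d \<in> ?D" for d
    using finite_conquester_chains[OF pos[OF that]] by simp
  have notin: "n \<notin> C" if "d \<in> ?D" "C \<in> conquester_chains d" for d C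
    using that proper_divisor_chain_notin by blast
  have card: "card (?K d) = \<psi> d" if "d \<in> ?D" for d
  proof -
    have "inj_on (insert n) (conquester_chains d)"
      using notin[OF that] by (intro inj_onI) (metis insert_ident)
    then show ?thesis
      by (simp add: card_image psi_eq_card_conquester_chains)
  qed
  have disj: "?K d \<inter> ?K e = {}" if "d \<in> ?D" "e \<in> ?D" "d \<noteq> e" for d e
  proof (rule ccontr)
    assume "?K d \<inter> ?K e \<noteq> {}"
    then obtain C C' where "C \<in> conquester_chains d" "C' \<in> conquester_chains e"
      "insert n C = insert n C'"
      by blast
    moreover from this have "C = C'"
      using notin that by (metis insert_ident)
    ultimately show False
      using conquester_chains_disjoint pos that by blast
  qed
  have "{n} \<notin> (\<Union>d\<in>?D. ?K d)"
  proof
    assume "{n} \<in> (\<Union>d\<in>?D. ?K d)"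
    then obtain d C where d: "d \<in> ?D" and C: "C \<in> conquester_chains d" "insert n C = {n}"
      by (metis (no_types, lifting) UN_E imageE)
    from C(2) notin[OF d C(1)] have "C = {}"
      by blast
    with C(1) show False
      by (simp add: conquester_chains_def conquester_chain_def)
  qed
  moreover have "finite (\<Union>d\<in>?D. ?K d)"
    using fin finK by blast
  ultimately have "\<psi> n = 1 + card (\<Union>d\<in>?D. ?K d)"
    by (simp add: psi_eq_card_conquester_chains conquester_chains_decomposition[OF assms])
  also have "card (\<Union>d\<in>?D. ?K d) = (\<Sum>d\<in>?D. card (?K d))"
    using fin finK disj by (intro card_UN_disjoint) blast+
  also have "\<dots> = (\<Sum>d\<in>?D. \<psi> d)"
    using card by (intro sum.cong) auto
  finally show ?thesis .
qed

lemma proper_divisors_prime_power: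
  fixes p :: nat
  assumes "prime p"
  shows "{d. d dvd p ^ k \<and> d \<noteq> p ^ k} = (\<lambda>i. p ^ i) ` {..<k}"
proof -
  have "p ^ i = p ^ j \<longleftrightarrow> i = j" for i j
    using prime_gt_1_nat[OF assms] by simp
  then show ?thesis
    by (auto simp: divides_primepow_nat[OF assms] le_less)
qed

lemma psi_prime_power:
  assumes "prime p"
  shows "\<psi> (p ^ k) = 2 ^ k"
proof (induction k rule: less_induct)
  case (less k)
  have gt1: "p > 1"
    using assms by (rule prime_gt_1_nat)
  then have "\<psi> (p ^ k) = 1 + (\<Sum>d\<in>(\<lambda>i. p ^ i) ` {..<k}. \<psi> d)"
    by (subst psi_recurrence) (simp_all add: proper_divisors_prime_power[OF assms])
  also have "(\<Sum>d\<in>(\<lambda>i. p ^ i) ` {..<k}. \<psi> d) = (\<Sum>i<k. \<psi> (p ^ i))"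
    using gt1 by (subst sum.reindex) (auto simp: inj_on_def)
  also have "\<dots> = (\<Sum>i<k. 2 ^ i)"
    using less by simp
  also have "1 + \<dots> = (2::nat) ^ k"
    by (induction k) auto
  finally show ?case .
qed

theorem lemma4p5:
  fixes n :: nat
  assumes "n > 0"
  shows "\<psi> n = 1 + (\<Sum>d | d dvd n \<and> d \<noteq> n. \<psi> d) \<and>
    \<psi> 1 = 1 \<and>
    (\<forall>(p::nat) (\<alpha>::nat). prime p \<and> \<alpha> > 0 \<longrightarrow> \<psi> (p ^ \<alpha>) = 2 ^ \<alpha>)"
proof (intro conjI allI impI)
  show "\<psi> n = 1 + (\<Sum>d | d dvd n \<and> d \<noteq> n. \<psi> d)"
    using assms by (rule psi_recurrence)
  show "\<psi> 1 = 1"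
    using psi_recurrence[of 1] by simp
  show "\<psi> (p ^ \<alpha>) = 2 ^ \<alpha>" if "prime p \<and> \<alpha> > 0" for p \<alpha> :: nat
    using that by (simp add: psi_prime_power)
qed

end
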